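(* Let $n$ be a positive integer, let $k,m$ be nonnegative integers, and let $F$ be a field of characteristic $p$, where $p$ is a prime or $p=\infty$ (the latter meaning characteristic $0$). Let $T$ be a nonempty subset of $\{1,\ldots,n\}$. For $i,j=1,\ldots,n$ with $i\neq j$, let $A_i$ and $S_{ij}$ be subsets of $F$ with $|A_i|=k$ and $|S_{ij}|\leqslant 2m$. Let $\alpha_{ij}\in F$ (for $i,j\in T$, $i\neq j$) satisfy $\sum_{i,j\in T,\, i\neq j}\alpha_{ij}\neq 0$. If $p>\max\{mn,\,(k-1)n-mn(n-1)-2\}$, then the set $$C=\Big\{a_1+\cdots+a_n:\ a_1\in A_1,\ldots,a_n\in A_n,\ a_i-a_j\notin S_{ij}\text{ whenever } i\neq j,\ \text{and } \sum_{i,j\in T,\, i\neq j}\alpha_{ij} a_ia_j\neq 0\Big\}$$ satisfies $|C|\geqslant (k+m-mn-1)n-1$.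
   Context: If the characteristic of $F$ is $0$, then $p=\infty$ and any inequality of the form $p>N$ holds automatically. The sums over $i,j\in T$, $i\neq j$, run over ordered pairs.
   Formalization: The sets S_ij and the condition a_i-a_j∉S_ij are taken only for i<j (one set of at most 2m forbidden differences per unordered pair); with independent S_ij and S_ji the claim is false, e.g. over Q with n=2, m=1, k=4, A_i={0,1,2,3}, S_12={0,1}, S_21={1,-2}, α_12=1, α_21=0. *)

theory Defs
  imports Complex_Main
begin

text \<open>
  The family \<open>S\<close> supplies one set of forbidden differences for each unordered pair of indices,
  the difference being taken as \<open>a i - a j\<close> with \<open>i < j\<close>; only the entries \<open>S i j\<close> with \<open>i < j\<close>
  are used.  Imposing independent conditions \<open>a i - a j \<notin> S i j\<close> and \<open>a j - a i \<notin> S j i\<close>,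
  each with a set of size up to \<open>2 * m\<close>, would make the bound false: over the rationals take
  \<open>n = 2\<close>, \<open>m = 1\<close>, \<open>k = 4\<close>, \<open>A 1 = A 2 = {0, 1, 2, 3}\<close>, \<open>S 1 2 = {0, 1}\<close>, \<open>S 2 1 = {1, - 2}\<close>
  and \<open>\<alpha> 1 2 = 1\<close>, \<open>\<alpha> 2 1 = 0\<close>, \<open>T = {1, 2}\<close>; then \<open>C = {4}\<close>, whereas the bound is \<open>3\<close>.
  The sum over \<open>i\<close> and \<open>j\<close>, in contrast, runs over ordered pairs.
\<close>

definition restricted_sumset ::
  "nat \<Rightarrow> nat set \<Rightarrow> (nat \<Rightarrow> 'a::field set) \<Rightarrow> (nat \<Rightarrow> nat \<Rightarrow> 'a set) \<Rightarrow> (nat \<Rightarrow> nat \<Rightarrow> 'a) \<Rightarrow> 'a set"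
  where
  "restricted_sumset n T A S \<alpha> =
     {\<Sum>i=1..n. a i | a.
        (\<forall>i\<in>{1..n}. a i \<in> A i) \<and>
        (\<forall>i\<in>{1..n}. \<forall>j\<in>{1..n}. i < j \<longrightarrow> a i - a j \<notin> S i j) \<and>
        (\<Sum>i\<in>T. \<Sum>j\<in>T - {i}. \<alpha> i j * a i * a j) \<noteq> 0}"

end

theory Submission
  imports Defs "HOL-Library.FuncSet" "HOL-Computational_Algebra.Polynomial"
    "HOL-Combinatorics.Permutations"
begin

text \<open>
  For finite grids \<open>A i\<close> of size \<open>d i + 1\<close>, the linear functional
  \<open>f \<mapsto> \<Sum>x. f x / (\<Prod>i. \<Prod>c\<in>A i - {x i}. x i - c)\<close>, the sum running over the grid, extracts the
  coefficient of \<open>\<Prod>i. x i ^ d i\<close> from every polynomial of total degree at most \<open>\<Sum>i. d i\<close>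
  (a quantitative Combinatorial Nullstellensatz).  Let \<open>K = k - 1\<close> and
  \<open>N = K n - m n (n - 1) - 2\<close>.  If the restricted sumset \<open>C\<close> had at most \<open>N\<close> elements, the product
  of the quadratic form, the factors \<open>x i - x j - s\<close> with \<open>s \<in> S i j\<close> and the factors
  \<open>x 1 + \<dots> + x n - c\<close> with \<open>c \<in> C\<close>, padded to degree \<open>K n\<close>, would vanish on the product of
  the \<open>A i\<close>.  Looking only at top-degree parts and using symmetry, the coefficient of
  \<open>\<Prod>i. x i ^ K\<close> in \<open>x 1 * x n * (\<Prod>i<j. (x i - x j) ^ (2 m)) * (x 1 + \<dots> + x n) ^ N\<close> would be
  zero in the field.

  Divide by \<open>x 1 * x n\<close> and evaluate that coefficient on the smaller grid with \<open>x 1 \<in> {1..K}\<close>,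
  \<open>x n \<in> {0..K - 1}\<close> and the other coordinates in \<open>{0..K}\<close>, after replacing \<open>(x i - x j) ^ (2 m)\<close>
  by \<open>\<Prod>s = 1 - m..m. x i - x j - s\<close> and the power of the sum by a product over all admissible
  sums but the smallest.  Just one grid point gives a nonzero value, so the coefficient is a
  single product, whose factors the bound on the characteristic keeps nonzero.
\<close>

section \<open>Lagrange interpolation and the coefficient functional on grids\<close>

text \<open>Interpolating \<open>X ^ b\<close> at the points of \<open>A\<close> gives
  \<open>X ^ b\<close> back, as the difference \<open>p\<close> has degree below
  \<open>card A\<close> and vanishes on \<open>A\<close>. The sum is the coefficient of
  \<open>X ^ (card A - 1)\<close> in the interpolant, each \<open>Q c\<close> being monic of that
  degree.\<close>

lemma lagrange_leading_coeff:
  fixes A :: "'a::field set"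
  assumes fin: "finite A" and b: "b < card A"
  shows "(\<Sum>c\<in>A. c ^ b / (\<Prod>d\<in>A - {c}. c - d)) = (if Suc b = card A then 1 else 0)"
proof -
  define w where "w c = c ^ b / (\<Prod>d\<in>A - {c}. c - d)" for c :: 'a
  define Q where "Q c = (\<Prod>d\<in>A - {c}. [:- d, 1:])" for c :: 'a
  define p where "p = (\<Sum>c\<in>A. smult (w c) (Q c)) - monom 1 b"
  have degQ: "degree (Q c) = card A - 1" if "c \<in> A" for c
    using that fin by (simp add: Q_def degree_prod_eq_sum_degree)
  have leadQ: "coeff (Q c) (card A - 1) = 1" if "c \<in> A" for c
    using degQ[OF that] lead_coeff_prod[of "\<lambda>d. [:- d, 1:]" "A - {c}"] by (simp add: Q_def)
  have degp: "degree p < card A"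
  proof -
    have "degree (\<Sum>c\<in>A. smult (w c) (Q c)) \<le> card A - 1"
      using degQ by (intro degree_sum_le fin) (auto intro: order.trans[OF degree_smult_le])
    moreover have "degree (monom (1::'a) b) \<le> card A - 1"
      using b by (simp add: degree_monom_eq)
    ultimately have "degree p \<le> card A - 1"
      unfolding p_def by (rule degree_diff_le)
    with b show ?thesis by linarith
  qed
  have root: "poly p x = 0" if x: "x \<in> A" for x
  proof -
    have "w c * poly (Q c) x = (if c = x then x ^ b else 0)" if "c \<in> A" for c
    proof (cases "c = x")
      case True
      have "(\<Prod>d\<in>A - {x}. x - d) \<noteq> 0" using fin by auto
      with True show ?thesis by (simp add: w_def Q_def poly_prod)
    next
      case False
      with x fin have "(\<Prod>d\<in>A - {c}. x - d) = 0" by (intro prod_zero) auto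
      with False show ?thesis by (simp add: Q_def poly_prod)
    qed
    then have "(\<Sum>c\<in>A. w c * poly (Q c) x) = (\<Sum>c\<in>A. if c = x then x ^ b else 0)"
      by (rule sum.cong[OF refl])
    with x fin show ?thesis by (simp add: p_def poly_sum poly_monom)
  qed
  have "p = 0"
  proof (rule ccontr)
    assume "p \<noteq> 0"
    then have "finite {x. poly p x = 0}" "card {x. poly p x = 0} \<le> degree p"
      by (simp_all add: poly_roots_finite card_poly_roots_bound)
    moreover have "card A \<le> card {x. poly p x = 0}"
      using root by (intro card_mono calculation) auto
    ultimately show False using degp by simp
  qed
  then have "coeff (\<Sum>c\<in>A. smult (w c) (Q c)) (card A - 1) = coeff (monom 1 b) (card A - 1)"
    by (simp add: p_def)
  then have "(\<Sum>c\<in>A. w c) = coeff (monom 1 b) (card A - 1)"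
    using leadQ by (simp add: coeff_sum)
  then show ?thesis using b by (auto simp: w_def)
qed

text \<open>The tensor product over \<open>V\<close> of the one-variable divided differences with
  nodes \<open>A i\<close>.\<close>

definition grid_functional ::
  "'i set \<Rightarrow> ('i \<Rightarrow> 'a::field set) \<Rightarrow> (('i \<Rightarrow> 'a) \<Rightarrow> 'a) \<Rightarrow> 'a" where
  "grid_functional V A f =
     (\<Sum>x\<in>PiE V A. f x / (\<Prod>i\<in>V. \<Prod>c\<in>A i - {x i}. x i - c))"

lemma grid_functional_add:
  "grid_functional V A (\<lambda>x. f x + g x) = grid_functional V A f + grid_functional V A g"
  by (simp add: grid_functional_def add_divide_distrib sum.distrib)

lemma grid_functional_diff:
  "grid_functional V A (\<lambda>x. f x - g x) = grid_functional V A f - grid_functional V A g"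
  by (simp add: grid_functional_def diff_divide_distrib sum_subtractf)

lemma grid_functional_cmult:
  "grid_functional V A (\<lambda>x. c * f x) = c * grid_functional V A f"
  by (simp add: grid_functional_def sum_distrib_left)

lemma grid_functional_sum:
  "grid_functional V A (\<lambda>x. \<Sum>i\<in>I. f i x) = (\<Sum>i\<in>I. grid_functional V A (f i))"
  unfolding grid_functional_def by (subst sum.swap) (simp add: sum_divide_distrib)

text \<open>The sum over the grid factors into one-variable sums. Unless \<open>b = d\<close> on
  \<open>V\<close>, the degree bound forces some \<open>b i < d i\<close>, and that factor vanishes,
  however large the other exponents are.\<close>

lemma grid_functional_monomial:
  assumes V: "finite V" and fin: "\<And>i. i \<in> V \<Longrightarrow> finite (A i)"
    and card: "\<And>i. i \<in> V \<Longrightarrow> card (A i) = Suc (d i)"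
    and deg: "sum b V \<le> sum d V"
  shows "grid_functional V A (\<lambda>x. \<Prod>i\<in>V. x i ^ b i) = (if \<forall>i\<in>V. b i = d i then 1 else 0)"
proof -
  have "grid_functional V A (\<lambda>x. \<Prod>i\<in>V. x i ^ b i) =
      (\<Prod>i\<in>V. \<Sum>c\<in>A i. c ^ b i / (\<Prod>e\<in>A i - {c}. c - e))"
    using V fin by (simp add: grid_functional_def prod_sum_PiE prod_dividef)
  also have "\<dots> = (if \<forall>i\<in>V. b i = d i then 1 else 0)"
  proof (cases "\<forall>i\<in>V. b i = d i")
    case True
    then show ?thesis using fin card by (simp add: lagrange_leading_coeff)
  next
    case False
    have "\<exists>i\<in>V. b i < d i"
    proof (rule ccontr)
      assume "\<not> ?thesis"
      then have le: "\<forall>i\<in>V. d i \<le> b i" by auto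
      with False have "\<exists>i\<in>V. d i < b i" by (metis le_neq_implies_less)
      with le V have "sum d V < sum b V" by (intro sum_strict_mono_ex1) auto
      with deg show False by simp
    qed
    then obtain i where "i \<in> V" "b i < d i" by blast
    then have "(\<Sum>c\<in>A i. c ^ b i / (\<Prod>e\<in>A i - {c}. c - e)) = 0"
      using fin card by (simp add: lagrange_leading_coeff)
    with \<open>i \<in> V\<close> V False show ?thesis by (metis (mono_tags, lifting) prod_zero)
  qed
  finally show ?thesis .
qed

section \<open>Polynomial functions of bounded degree\<close>

text \<open>The degree bound is strict, so that \<open>D = 0\<close> leaves only the zero function.\<close>

inductive poly_fun :: "'i set \<Rightarrow> nat \<Rightarrow> (('i \<Rightarrow> 'a::comm_ring_1) \<Rightarrow> 'a) \<Rightarrow> bool"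
  for V :: "'i set" and D :: nat where
  zero: "poly_fun V D (\<lambda>_. 0)"
| add_monomial: "sum b V < D \<Longrightarrow> poly_fun V D f \<Longrightarrow>
    poly_fun V D (\<lambda>x. c * (\<Prod>i\<in>V. x i ^ b i) + f x)"

lemma poly_fun_monomial: "sum b V < D \<Longrightarrow> poly_fun V D (\<lambda>x. c * (\<Prod>i\<in>V. x i ^ b i))"
  using poly_fun.add_monomial[OF _ poly_fun.zero] by fastforce

lemma poly_fun_add: "poly_fun V D f \<Longrightarrow> poly_fun V D g \<Longrightarrow> poly_fun V D (\<lambda>x. f x + g x)"
proof (induction rule: poly_fun.induct)
  case (add_monomial b f c)
  then show ?case
    using poly_fun.add_monomial[of b V D "\<lambda>x. f x + g x" c] by (simp add: add.assoc)
qed simp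

lemma poly_fun_monomial_mult:
  "poly_fun V (Suc E) g \<Longrightarrow> sum b V < D \<Longrightarrow>
    poly_fun V (D + E) (\<lambda>x. c * (\<Prod>i\<in>V. x i ^ b i) * g x)"
proof (induction rule: poly_fun.induct)
  case zero
  then show ?case by (simp add: poly_fun.zero)
next
  case (add_monomial b' g c')
  then have "poly_fun V (D + E) (\<lambda>x. (c * c') * (\<Prod>i\<in>V. x i ^ (b i + b' i)))"
    by (intro poly_fun_monomial) (simp add: sum.distrib)
  from poly_fun_add[OF this add_monomial.IH[OF add_monomial.prems]] show ?case
    by (simp add: power_add prod.distrib algebra_simps)
qed

text \<open>As the bounds are strict, degree below \<open>D\<close> times degree at most
  \<open>E\<close> stays below \<open>D + E\<close>; hence \<open>Suc\<close> on one factor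
  only.\<close>

lemma poly_fun_mult:
  "poly_fun V D f \<Longrightarrow> poly_fun V (Suc E) g \<Longrightarrow> poly_fun V (D + E) (\<lambda>x. f x * g x)"
proof (induction rule: poly_fun.induct)
  case zero
  then show ?case by (simp add: poly_fun.zero)
next
  case (add_monomial b f c)
  from poly_fun_add[OF poly_fun_monomial_mult[OF add_monomial.prems add_monomial.hyps(1)]
      add_monomial.IH[OF add_monomial.prems]]
  show ?case by (simp add: algebra_simps)
qed

lemma poly_fun_const: "0 < D \<Longrightarrow> poly_fun V D (\<lambda>_. c)"
  using poly_fun_monomial[of "\<lambda>_. 0" V D c] by simp

lemma poly_fun_cmult: "poly_fun V D f \<Longrightarrow> poly_fun V D (\<lambda>x. c * f x)"
  using poly_fun_mult[OF _ poly_fun_const, of V D f 0 c] by (simp add: mult.commute)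

lemma poly_fun_diff: "poly_fun V D f \<Longrightarrow> poly_fun V D g \<Longrightarrow> poly_fun V D (\<lambda>x. f x - g x)"
  using poly_fun_add[OF _ poly_fun_cmult, of V D f g "- 1"] by simp

lemma poly_fun_sum:
  assumes "\<And>i. i \<in> I \<Longrightarrow> poly_fun V D (f i)"
  shows "poly_fun V D (\<lambda>x. \<Sum>i\<in>I. f i x)"
  using assms
  by (induction I rule: infinite_finite_induct) (auto intro: poly_fun.zero poly_fun_add)

lemma poly_fun_var:
  fixes i :: 'i
  assumes "finite V" "i \<in> V" "1 < D"
  shows "poly_fun V D (\<lambda>x. x i :: 'a::comm_ring_1)"
proof -
  have "(\<Prod>j\<in>V. x j ^ (if j = i then 1 else 0)) = x i" for x :: "'i \<Rightarrow> 'a"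
    using assms by (simp add: if_distrib[of "(^) _"] prod.delta cong: if_cong)
  moreover have "poly_fun V D (\<lambda>x. (1::'a) * (\<Prod>j\<in>V. x j ^ (if j = i then 1 else 0)))"
    using assms by (intro poly_fun_monomial) (simp add: sum.delta)
  ultimately show ?thesis by (simp only: mult_1)
qed

lemma grid_functional_low_degree:
  assumes V: "finite V" and fin: "\<And>i. i \<in> V \<Longrightarrow> finite (A i)"
    and card: "\<And>i. i \<in> V \<Longrightarrow> card (A i) = Suc (d i)"
    and f: "poly_fun V (sum d V) f"
  shows "grid_functional V A f = 0"
  using f
proof (induction rule: poly_fun.induct)
  case zero
  show ?case by (simp add: grid_functional_def)
next
  case (add_monomial b f c)
  moreover from this(1) have "\<not> (\<forall>i\<in>V. b i = d i)" by (metis less_irrefl sum.cong)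
  ultimately show ?case
    using V fin card grid_functional_monomial[of V A d b]
    by (auto simp: grid_functional_add grid_functional_cmult)
qed

text \<open>Both sides read off the coefficient of the monomial with exponents \<open>d\<close> in
  \<open>f\<close>. With \<open>e = 0\<close> this exchanges grids of equal size; with
  \<open>e\<close> supported on two coordinates it divides by \<open>x 1 * x n\<close>.\<close>

lemma grid_functional_shift:
  assumes V: "finite V" and finA: "\<And>i. i \<in> V \<Longrightarrow> finite (A i)"
    and finB: "\<And>i. i \<in> V \<Longrightarrow> finite (B i)"
    and cardB: "\<And>i. i \<in> V \<Longrightarrow> card (B i) = Suc (d i)"
    and cardA: "\<And>i. i \<in> V \<Longrightarrow> card (A i) = Suc (d i + e i)"
    and f: "poly_fun V (Suc (sum d V)) f"
  shows "grid_functional V A (\<lambda>x. (\<Prod>i\<in>V. x i ^ e i) * f x) = grid_functional V B f"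
  using f
proof (induction rule: poly_fun.induct)
  case zero
  show ?case by (simp add: grid_functional_def)
next
  case (add_monomial b f c)
  have A: "grid_functional V A (\<lambda>x. \<Prod>i\<in>V. x i ^ (b i + e i)) =
      (if \<forall>i\<in>V. b i = d i then 1 else 0)"
    using grid_functional_monomial[of V A "\<lambda>i. d i + e i" "\<lambda>i. b i + e i"] V finA cardA add_monomial(1)
    by (simp add: sum.distrib)
  have "(\<Prod>i\<in>V. x i ^ e i) * (c * (\<Prod>i\<in>V. x i ^ b i) + f x) =
     c * (\<Prod>i\<in>V. x i ^ (b i + e i)) + (\<Prod>i\<in>V. x i ^ e i) * f x" for x
    by (simp add: power_add prod.distrib algebra_simps)
  then show ?case
    using A add_monomial V finB cardB grid_functional_monomial[of V B d b]
    by (simp add: grid_functional_add grid_functional_cmult)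
qed

section \<open>Equality of top-degree parts\<close>

text \<open>Over a finite field a function has several polynomial representations, so only some
  representation of the difference is asked to have degree below \<open>D\<close>. This suffices for
  the grid functional.\<close>

definition same_top :: "'i set \<Rightarrow> nat \<Rightarrow> (('i \<Rightarrow> 'a::comm_ring_1) \<Rightarrow> 'a) \<Rightarrow> (('i \<Rightarrow> 'a) \<Rightarrow> 'a) \<Rightarrow> bool"
  where "same_top V D f g \<longleftrightarrow>
    poly_fun V (Suc D) f \<and> poly_fun V (Suc D) g \<and> poly_fun V D (\<lambda>x. f x - g x)"

lemma same_top_refl: "poly_fun V (Suc D) f \<Longrightarrow> same_top V D f f"
  by (simp add: same_top_def poly_fun.zero)

lemma same_top_mult:
  assumes "same_top V D f g" "same_top V E f' g'"
  shows "same_top V (D + E) (\<lambda>x. f x * f' x) (\<lambda>x. g x * g' x)"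
proof -
  have "poly_fun V (D + E) (\<lambda>x. (f x - g x) * f' x)"
    using assms poly_fun_mult by (auto simp: same_top_def)
  moreover have "poly_fun V (E + D) (\<lambda>x. (f' x - g' x) * g x)"
    using assms poly_fun_mult by (auto simp: same_top_def)
  ultimately have "poly_fun V (D + E) (\<lambda>x. (f x - g x) * f' x + (f' x - g' x) * g x)"
    by (intro poly_fun_add) (simp_all add: add.commute)
  then have "poly_fun V (D + E) (\<lambda>x. f x * f' x - g x * g' x)"
    by (simp add: algebra_simps)
  moreover have "poly_fun V (Suc D + E) (\<lambda>x. f x * f' x)" "poly_fun V (Suc D + E) (\<lambda>x. g x * g' x)"
    using assms by (auto simp: same_top_def intro: poly_fun_mult simp del: add_Suc)
  ultimately show ?thesis by (simp add: same_top_def)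
qed

lemma same_top_prod:
  assumes "\<And>i. i \<in> I \<Longrightarrow> same_top V (D i) (f i) (g i)"
  shows "same_top V (sum D I) (\<lambda>x. \<Prod>i\<in>I. f i x) (\<lambda>x. \<Prod>i\<in>I. g i x)"
  using assms
  by (induction I rule: infinite_finite_induct)
    (auto intro: same_top_refl poly_fun_const same_top_mult)

lemma same_top_shift:
  assumes "poly_fun V 2 f"
  shows "same_top V 1 (\<lambda>x. f x - c) f"
proof -
  have "poly_fun V 2 (\<lambda>x. f x - c)" using assms by (intro poly_fun_diff poly_fun_const) auto
  moreover have "poly_fun V 1 (\<lambda>x. (f x - c) - f x)" using poly_fun_const[of 1 V "- c"] by simp
  ultimately show ?thesis using assms by (simp add: same_top_def numeral_2_eq_2)
qed

lemma same_top_prod_shift: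
  assumes "poly_fun V 2 f"
  shows "same_top V (card I) (\<lambda>x. \<Prod>i\<in>I. f x - c i) (\<lambda>x. f x ^ card I)"
  using same_top_prod[of I V "\<lambda>_. 1" "\<lambda>i x. f x - c i" "\<lambda>_. f"] same_top_shift[OF assms] by simp

lemma same_top_power:
  assumes "same_top V D f g"
  shows "same_top V (D * e) (\<lambda>x. f x ^ e) (\<lambda>x. g x ^ e)"
  using same_top_prod[of "{..<e}" V "\<lambda>_. D" "\<lambda>_. f" "\<lambda>_. g"] assms by (simp add: mult.commute)

lemma grid_functional_same_top:
  assumes "finite V" "\<And>i. i \<in> V \<Longrightarrow> finite (A i)"
    "\<And>i. i \<in> V \<Longrightarrow> card (A i) = Suc (d i)" "same_top V (sum d V) f g"
  shows "grid_functional V A f = grid_functional V A g"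
  using grid_functional_low_degree[of V A d "\<lambda>x. f x - g x"] assms
  by (simp add: same_top_def grid_functional_diff)

text \<open>With one node set for all coordinates, composing with \<open>\<pi>\<close> permutes the
  grid and only reorders the factors of each denominator.\<close>

lemma grid_functional_permute:
  fixes E :: "'a::field set" and V :: "'b set"
  assumes "\<pi> permutes V"
  shows "grid_functional V (\<lambda>_. E) (\<lambda>x. f (x \<circ> \<pi>)) = grid_functional V (\<lambda>_. E) f"
proof -
  have maps: "x \<circ> \<sigma> \<in> PiE V (\<lambda>_. E)" if "x \<in> PiE V (\<lambda>_. E)" "\<sigma> permutes V" for x \<sigma>
    using that by (auto simp: PiE_iff extensional_def permutes_in_image)
  have den: "(\<Prod>i\<in>V. \<Prod>c\<in>E - {x (\<pi> i)}. x (\<pi> i) - c) = (\<Prod>i\<in>V. \<Prod>c\<in>E - {x i}. x i - c)"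
    for x :: "'b \<Rightarrow> 'a"
    using prod.permute[OF assms, of "\<lambda>i. \<Prod>c\<in>E - {x i}. x i - c"] by (simp add: comp_def)
  have "grid_functional V (\<lambda>_. E) f =
    (\<Sum>x\<in>PiE V (\<lambda>_. E). f (x \<circ> \<pi>) / (\<Prod>i\<in>V. \<Prod>c\<in>E - {x (\<pi> i)}. x (\<pi> i) - c))"
    unfolding grid_functional_def
    by (rule sum.reindex_bij_witness[of _ "\<lambda>x. x \<circ> \<pi>" "\<lambda>x. x \<circ> inv \<pi>"])
      (use assms maps permutes_inv[OF assms] in \<open>auto simp: comp_assoc permutes_inv_o permutes_inverses[OF assms]\<close>)
  then show ?thesis by (simp add: grid_functional_def den)
qed

section \<open>Extremal sums of separated integer sequences\<close>

text \<open>The first conjunct is only needed to carry the induction, which removes a point where \<open>x\<close> is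
  largest.\<close>

lemma separated_sum:
  fixes x :: "'i::linorder \<Rightarrow> int" and m :: nat
  assumes "finite I" "\<And>i. i \<in> I \<Longrightarrow> 0 \<le> x i"
    and "\<And>i j. i \<in> I \<Longrightarrow> j \<in> I \<Longrightarrow> i < j \<Longrightarrow> x i + int m \<le> x j \<or> x j + int m < x i"
  shows "(I \<noteq> {} \<longrightarrow> (\<exists>w\<in>I. int m * (int (card I) - 1) \<le> x w)) \<and>
    int m * (int (card I) * (int (card I) - 1)) \<le> 2 * sum x I \<and>
    (2 * sum x I = int m * (int (card I) * (int (card I) - 1)) \<longrightarrow>
      (\<forall>i\<in>I. x i = int m * int (card {j\<in>I. j < i})))"
  using assms
proof (induction "card I" arbitrary: I)
  case 0
  then show ?case by simp
next
  case (Suc n)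
  from Suc.hyps(2) Suc.prems(1) have "I \<noteq> {}" by auto
  define w where "w = (SOME w. w \<in> I \<and> x w = Max (x ` I))"
  have "Max (x ` I) \<in> x ` I" using Suc.prems(1) \<open>I \<noteq> {}\<close> by simp
  then have "\<exists>w. w \<in> I \<and> x w = Max (x ` I)" by (metis imageE)
  then have "w \<in> I \<and> x w = Max (x ` I)" unfolding w_def by (rule someI_ex)
  then have w: "w \<in> I" "\<And>j. j \<in> I \<Longrightarrow> x j \<le> x w" using Suc.prems(1) by auto
  define R where "R = I - {w}"
  have IR: "I = insert w R" "w \<notin> R" "finite R" using w Suc.prems(1) by (auto simp: R_def)
  have n: "n = card R" using Suc.hyps(2) IR by simp
  have gap: "x j + int m \<le> x w" if "j \<in> R" for j
  proof -
    have "j \<in> I" "j \<noteq> w" using that IR by auto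
    then show ?thesis
      using Suc.prems(3)[of j w] Suc.prems(3)[of w j] w(1) w(2)[of j]
      by (cases j w rule: linorder_cases) auto
  qed
  have R_nonneg: "0 \<le> x i" if "i \<in> R" for i
    using that IR(1) by (intro Suc.prems(2)) simp
  have R_sep: "x i + int m \<le> x j \<or> x j + int m < x i" if "i \<in> R" "j \<in> R" "i < j" for i j
    using that IR(1) by (intro Suc.prems(3)) simp_all
  have "(R \<noteq> {} \<longrightarrow> (\<exists>w\<in>R. int m * (int (card R) - 1) \<le> x w)) \<and>
    int m * (int (card R) * (int (card R) - 1)) \<le> 2 * sum x R \<and>
    (2 * sum x R = int m * (int (card R) * (int (card R) - 1)) \<longrightarrow>
      (\<forall>i\<in>R. x i = int m * int (card {j\<in>R. j < i})))"
    by (rule Suc.hyps(1)[OF n IR(3)]) (erule R_nonneg, erule (2) R_sep)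
  then have IH: "R \<noteq> {} \<Longrightarrow> \<exists>w\<in>R. int m * (int n - 1) \<le> x w"
    "int m * (int n * (int n - 1)) \<le> 2 * sum x R"
    "2 * sum x R = int m * (int n * (int n - 1)) \<Longrightarrow> i \<in> R \<Longrightarrow> x i = int m * int (card {j\<in>R. j < i})" for i
    unfolding n[symmetric] by blast+
  have xw: "int m * int n \<le> x w"
  proof (cases "R = {}")
    case True
    then show ?thesis using n Suc.prems(2) w by simp
  next
    case False
    then obtain v where "v \<in> R" "int m * (int n - 1) \<le> x v" using IH(1) by blast
    with gap[of v] show ?thesis by (simp add: algebra_simps)
  qed
  have sum: "sum x I = x w + sum x R" using IR by simp
  have cardI: "int (card I) = int n + 1" using Suc.hyps(2) by simp
  have split: "int m * (int (card I) * (int (card I) - 1)) =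
      2 * (int m * int n) + int m * (int n * (int n - 1))"
    unfolding cardI by (simp add: algebra_simps)
  have "\<forall>i\<in>I. x i = int m * int (card {j\<in>I. j < i})"
    if eq: "2 * sum x I = int m * (int (card I) * (int (card I) - 1))"
  proof -
    from eq split sum xw IH(2) have e: "x w = int m * int n" "2 * sum x R = int m * (int n * (int n - 1))"
      by linarith+
    show ?thesis
    proof (cases "m = 0")
      case True
      then show ?thesis using IR e IH(3) by auto
    next
      case False
      \<comment> \<open>The tight case for \<open>R\<close> gives its last index \<open>?M\<close>
        the value \<open>m * (n - 1)\<close>, so \<open>x w\<close> is larger by exactly
        \<open>m\<close>. A gap of exactly \<open>m > 0\<close> is permitted only in the direction
        of the index order, whence \<open>?M < w\<close>.\<close>
      have last: "v < w" if "v \<in> R" for v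
      proof -
        let ?M = "Max R"
        have "R \<noteq> {}" using that by blast
        with IR(3) have M: "?M \<in> R" "\<And>j. j \<in> R \<Longrightarrow> j \<le> ?M" by simp_all
        have "{j\<in>R. j < ?M} = R - {?M}" using M by force
        then have "card {j\<in>R. j < ?M} = n - 1" using M IR n by simp
        moreover have "n > 0" using that IR n by (simp add: card_gt_0_iff) auto
        ultimately have "x ?M = int m * (int n - 1)" using IH(3)[OF e(2) M(1)] by (simp add: of_nat_diff)
        then have "x w = x ?M + int m" using e by (simp add: algebra_simps)
        moreover have "?M \<noteq> w" "?M \<in> I" using M IR by auto
        ultimately have "?M < w" using Suc.prems(3)[of w ?M] w(1) False by (cases ?M w rule: linorder_cases) auto
        with M(2)[OF that] show ?thesis by simp
      qed
      have "{j\<in>I. j < w} = R" using last IR by auto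
      moreover have "{j\<in>I. j < i} = {j\<in>R. j < i}" if "i \<in> R" for i
        using last[OF that] IR by auto
      ultimately show ?thesis using e IH(3) IR n by auto
    qed
  qed
  moreover have "\<exists>w\<in>I. int m * (int (card I) - 1) \<le> x w" using xw w cardI by auto
  moreover have "int m * (int (card I) * (int (card I) - 1)) \<le> 2 * sum x I"
    using split sum xw IH(2) by linarith
  ultimately show ?case by blast
qed

text \<open>Lowering \<open>x 1\<close> by one and moving it behind the last index gives a sequence of the kind
  treated in \<open>separated_sum\<close>.\<close>

lemma separated_sum_first_pos:
  fixes x :: "nat \<Rightarrow> int" and m n :: nat
  assumes n: "0 < n" and nonneg: "\<And>i. i \<in> {1..n} \<Longrightarrow> 0 \<le> x i" and pos: "0 < x 1"
    and sep: "\<And>i j. i \<in> {1..n} \<Longrightarrow> j \<in> {1..n} \<Longrightarrow> i < j \<Longrightarrow> x i + int m \<le> x j \<or> x j + int m < x i"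
  shows "int m * (int n * (int n - 1)) + 2 \<le> 2 * sum x {1..n}"
    and "2 * sum x {1..n} = int m * (int n * (int n - 1)) + 2 \<Longrightarrow> i \<in> {1..n} \<Longrightarrow>
      x i = (if i = 1 then int m * (int n - 1) + 1 else int m * (int i - 2))"
proof -
  \<comment> \<open>The alternative \<open>x i + m < x 1\<close> becomes
    \<open>y i + m \<le> y (Suc n)\<close>, and \<open>x 1 + m \<le> x i\<close> becomes
    \<open>y (Suc n) + m < y i\<close>, which is exactly what the pair \<open>i, Suc n\<close>
    requires.\<close>
  define y where "y i = (if i = Suc n then x 1 - 1 else x i)" for i
  have y: "y i + int m \<le> y j \<or> y j + int m < y i"
    if "i \<in> {2..Suc n}" "j \<in> {2..Suc n}" "i < j" for i j
    using that sep[of i j] sep[of 1 i] by (cases "j = Suc n") (auto simp: y_def)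
  have y0: "0 \<le> y i" if "i \<in> {2..Suc n}" for i
    using that nonneg[of i] pos by (auto simp: y_def)
  have "sum y {2..Suc n} = y (Suc n) + sum y {2..n}"
    using n by (simp add: sum.atLeast_Suc_atMost)
  also have "sum y {2..n} = sum x {2..n}" by (intro sum.cong) (auto simp: y_def)
  also have "y (Suc n) + sum x {2..n} = sum x {1..n} - 1"
    using n by (simp add: y_def sum.atLeast_Suc_atMost numeral_2_eq_2)
  finally have sum: "sum y {2..Suc n} = sum x {1..n} - 1" .
  have card: "int (card {2..Suc n}) = int n" by simp
  have aux: "a + 2 \<le> 2 * s" if "a \<le> 2 * (s - 1)" for a s :: int using that by simp
  have aux': "2 * (s - 1) = a" if "2 * s = a + 2" for a s :: int using that by simp
  have main: "int m * (int n * (int n - 1)) \<le> 2 * (sum x {1..n} - 1) \<and>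
      (2 * (sum x {1..n} - 1) = int m * (int n * (int n - 1)) \<longrightarrow>
        (\<forall>l\<in>{2..Suc n}. y l = int m * int (card {j\<in>{2..Suc n}. j < l})))"
    by (rule separated_sum[of "{2..Suc n}" y m, THEN conjunct2, unfolded sum card])
      (rule finite_atLeastAtMost, erule y0, erule (2) y)
  show "int m * (int n * (int n - 1)) + 2 \<le> 2 * sum x {1..n}"
    by (rule aux[OF conjunct1[OF main]])
  assume eq: "2 * sum x {1..n} = int m * (int n * (int n - 1)) + 2" and i: "i \<in> {1..n}"
  have val: "y l = int m * (int l - 2)" if "l \<in> {2..Suc n}" for l
  proof -
    have "{j \<in> {2..Suc n}. j < l} = {2..<l}" using that by auto
    moreover have "y l = int m * int (card {j \<in> {2..Suc n}. j < l})"
      by (rule bspec[OF mp[OF conjunct2[OF main] aux'[OF eq]] that])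
    ultimately show ?thesis using that by (simp add: of_nat_diff)
  qed
  show "x i = (if i = 1 then int m * (int n - 1) + 1 else int m * (int i - 2))"
    using val[of i] val[of "Suc n"] i n by (auto simp: y_def)
qed

text \<open>Passing to \<open>K - x (n + 1 - i)\<close> reverses both indices and values, so it
  preserves separation and turns \<open>x n < K\<close> into positivity at \<open>1\<close>; the
  lower bound of \<open>separated_sum_first_pos\<close> then applies.\<close>

lemma separated_sum_last_less:
  fixes x :: "nat \<Rightarrow> int" and m n :: nat
  assumes n: "0 < n" and le: "\<And>i. i \<in> {1..n} \<Longrightarrow> x i \<le> K" and less: "x n < K"
    and sep: "\<And>i j. i \<in> {1..n} \<Longrightarrow> j \<in> {1..n} \<Longrightarrow> i < j \<Longrightarrow> x i + int m \<le> x j \<or> x j + int m < x i"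
  shows "2 * sum x {1..n} \<le> 2 * (K * int n) - int m * (int n * (int n - 1)) - 2"
proof -
  have "(\<Sum>i=1..n. K - x (n + 1 - i)) = K * int n - (\<Sum>i=1..n. x (n + 1 - i))"
    by (simp add: sum_subtractf mult.commute)
  also have "(\<Sum>i=1..n. x (n + 1 - i)) = sum x {1..n}"
    using sum.atLeastAtMost_rev[of x 1 n] by (simp only: add.commute)
  finally have sum: "(\<Sum>i=1..n. K - x (n + 1 - i)) = K * int n - sum x {1..n}" .
  have "int m * (int n * (int n - 1)) + 2 \<le> 2 * (\<Sum>i=1..n. K - x (n + 1 - i))"
  proof (rule separated_sum_first_pos(1)[OF n])
    fix i j assume "i \<in> {1..n}" "j \<in> {1..n}" "i < j"
    then have "n + 1 - j \<in> {1..n}" "n + 1 - i \<in> {1..n}" "n + 1 - j < n + 1 - i" by auto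
    from sep[OF this] show "K - x (n + 1 - i) + int m \<le> K - x (n + 1 - j) \<or>
        K - x (n + 1 - j) + int m < K - x (n + 1 - i)"
      by linarith
  next
    fix i assume "i \<in> {1..n}"
    then have "n + 1 - i \<in> {1..n}" by auto
    from le[OF this] show "0 \<le> K - x (n + 1 - i)" by simp
  qed (use less in simp)
  then show ?thesis unfolding sum by simp
qed

section \<open>Top-degree parts of products of differences and sums\<close>

definition index_pairs :: "nat \<Rightarrow> (nat \<times> nat) set" where
  "index_pairs n = {(i, j). i \<in> {1..n} \<and> j \<in> {1..n} \<and> i < j}"

lemma finite_index_pairs [simp]: "finite (index_pairs n)"
  by (rule finite_subset[of _ "{1..n} \<times> {1..n}"]) (auto simp: index_pairs_def)

lemma card_index_pairs: "2 * card (index_pairs n) = n * (n - 1)"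
proof (induction n)
  case 0
  show ?case by (simp add: index_pairs_def)
next
  case (Suc n)
  have "index_pairs (Suc n) = index_pairs n \<union> (\<lambda>i. (i, Suc n)) ` {1..n}"
    by (auto simp: index_pairs_def)
  moreover have "index_pairs n \<inter> (\<lambda>i. (i, Suc n)) ` {1..n} = {}"
    by (auto simp: index_pairs_def)
  ultimately have "card (index_pairs (Suc n)) = card (index_pairs n) + n"
    by (simp add: card_Un_disjoint card_image inj_on_def)
  with Suc show ?case by (cases n) (simp_all add: algebra_simps)
qed

text \<open>The \<open>2 * m\<close>-th power of the Vandermonde product; the even exponent makes it
  symmetric.\<close>

definition difference_power :: "nat \<Rightarrow> nat \<Rightarrow> (nat \<Rightarrow> 'a::comm_ring_1) \<Rightarrow> 'a" where
  "difference_power n m x = (\<Prod>(i, j)\<in>index_pairs n. (x i - x j) ^ (2 * m))"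

text \<open>A product over all ordered pairs is visibly invariant under renaming indices; this is
  how \<open>difference_power_permute\<close> obtains the symmetry.\<close>

lemma difference_power_eq_ordered:
  "(\<Prod>(i, j)\<in>{(i, j). i \<in> {1..n} \<and> j \<in> {1..n} \<and> i \<noteq> j}. (x i - x j) ^ m) =
    ((- 1) ^ m) ^ card (index_pairs n) * difference_power n m (x :: nat \<Rightarrow> 'a::comm_ring_1)"
proof -
  let ?h = "\<lambda>(i, j). (x i - x j) ^ m"
  have "{(i, j). i \<in> {1..n} \<and> j \<in> {1..n} \<and> i \<noteq> j} = index_pairs n \<union> prod.swap ` index_pairs n"
    by (force simp: index_pairs_def image_iff)
  moreover have "index_pairs n \<inter> prod.swap ` index_pairs n = {}"
    by (auto simp: index_pairs_def)
  ultimately have "prod ?h {(i, j). i \<in> {1..n} \<and> j \<in> {1..n} \<and> i \<noteq> j} =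
      prod ?h (index_pairs n) * prod ?h (prod.swap ` index_pairs n)"
    by (simp add: prod.union_disjoint)
  also have "prod ?h (prod.swap ` index_pairs n) = (\<Prod>(i, j)\<in>index_pairs n. (x j - x i) ^ m)"
    by (subst prod.reindex) (auto simp: case_prod_unfold)
  also have "prod ?h (index_pairs n) * \<dots> =
      (\<Prod>(i, j)\<in>index_pairs n. (- 1) ^ m * (x i - x j) ^ (2 * m))"
  proof -
    have "(a - b) ^ m * (b - a) ^ m = (- 1) ^ m * (a - b) ^ (2 * m)" for a b :: 'a
    proof -
      have "(b - a) ^ m = (- 1) ^ m * (a - b) ^ m"
        by (simp flip: power_mult_distrib)
      then show ?thesis by (simp only: mult_2 power_add mult.left_commute)
    qed
    then show ?thesis by (simp add: case_prod_unfold flip: prod.distrib)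
  qed
  finally show ?thesis
    by (simp add: difference_power_def case_prod_unfold prod.distrib)
qed

lemma difference_power_permute:
  fixes x :: "nat \<Rightarrow> 'a::comm_ring_1"
  assumes \<pi>: "\<pi> permutes {1..n}"
  shows "difference_power n m (x \<circ> \<pi>) = difference_power n m x"
proof -
  let ?Q = "{(i, j). i \<in> {1..n} \<and> j \<in> {1..n} \<and> i \<noteq> j}"
  let ?s = "((- 1) ^ m) ^ card (index_pairs n) :: 'a"
  note simps = permutes_inverses[OF \<pi>] permutes_in_image[OF \<pi>]
    permutes_in_image[OF permutes_inv[OF \<pi>]]
    inj_eq[OF permutes_inj[OF \<pi>]] inj_eq[OF permutes_inj[OF permutes_inv[OF \<pi>]]]
  have "(\<Prod>(i, j)\<in>?Q. ((x \<circ> \<pi>) i - (x \<circ> \<pi>) j) ^ m) = (\<Prod>(i, j)\<in>?Q. (x i - x j) ^ m)"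
    by (rule prod.reindex_bij_witness[of _ "map_prod (inv \<pi>) (inv \<pi>)" "map_prod \<pi> \<pi>"])
      (auto simp: simps simp del: atLeastAtMost_iff One_nat_def)
  then have "?s * difference_power n m (x \<circ> \<pi>) = ?s * difference_power n m x"
    by (simp only: difference_power_eq_ordered)
  then have "?s * ?s * difference_power n m (x \<circ> \<pi>) = ?s * ?s * difference_power n m x"
    by (simp only: mult.assoc)
  moreover have "?s * ?s = 1"
    by (simp flip: power_mult_distrib)
  ultimately show ?thesis by simp
qed

text \<open>Shifts affect only lower-order terms, and copies of \<open>x i - x j\<close> fill up
  each pair to degree \<open>2 * m\<close>. Shifting through \<open>c\<close> lets the lemma serve
  for sets of field elements and for integer intervals alike.\<close>

lemma same_top_difference_power:
  fixes c :: "'s \<Rightarrow> 'a::comm_ring_1"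
  assumes I: "\<And>i j. (i, j) \<in> index_pairs n \<Longrightarrow> card (I i j) \<le> 2 * m"
  shows "same_top {1..n} (2 * m * card (index_pairs n))
    (\<lambda>x. \<Prod>(i, j)\<in>index_pairs n. (\<Prod>s\<in>I i j. x i - x j - c s) * (x i - x j) ^ (2 * m - card (I i j)))
    (difference_power n m)"
proof -
  have "same_top {1..n} (2 * m)
      (\<lambda>x. (\<Prod>s\<in>I i j. x i - x j - c s) * (x i - x j) ^ (2 * m - card (I i j)))
      (\<lambda>x. (x i - x j) ^ (2 * m))"
    if ij: "(i, j) \<in> index_pairs n" for i j
  proof -
    have lin: "poly_fun {1..n} 2 (\<lambda>x. x i - x j :: 'a)"
      using ij by (intro poly_fun_diff poly_fun_var) (auto simp: index_pairs_def)
    then have "same_top {1..n} 1 (\<lambda>x. x i - x j :: 'a) (\<lambda>x. x i - x j)"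
      by (intro same_top_refl) (simp add: numeral_2_eq_2)
    from same_top_mult[OF same_top_prod_shift[OF lin, of "I i j" c]
        same_top_power[OF this, of "2 * m - card (I i j)"]]
    show ?thesis using I[OF ij] by (simp flip: power_add)
  qed
  then show ?thesis
    using same_top_prod[of "index_pairs n" "{1..n}" "\<lambda>_. 2 * m"
        "\<lambda>(i, j) x. (\<Prod>s\<in>I i j. x i - x j - c s) * (x i - x j) ^ (2 * m - card (I i j))"
        "\<lambda>(i, j) x. (x i - x j) ^ (2 * m)"]
    by (auto simp: difference_power_def[abs_def] case_prod_unfold mult.commute)
qed

lemma poly_fun_sum_vars: "finite V \<Longrightarrow> poly_fun V 2 (\<lambda>x. \<Sum>i\<in>V. x i)"
  by (intro poly_fun_sum poly_fun_var) auto

lemma same_top_prod_sum_shift: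
  assumes "finite V"
  shows "same_top V (card I + e)
    (\<lambda>x. (\<Prod>t\<in>I. (\<Sum>i\<in>V. x i) - c t) * (\<Sum>i\<in>V. x i) ^ e)
    (\<lambda>x. (\<Sum>i\<in>V. x i) ^ (card I + e))"
proof -
  have "same_top V 1 (\<lambda>x. \<Sum>i\<in>V. x i) (\<lambda>x. \<Sum>i\<in>V. x i)"
    using poly_fun_sum_vars[OF assms] by (intro same_top_refl) (simp add: numeral_2_eq_2)
  from same_top_mult[OF same_top_prod_shift[OF poly_fun_sum_vars[OF assms]] same_top_power[OF this]]
  show ?thesis by (simp add: power_add)
qed

section \<open>Integers in the field and the bound on the characteristic\<close>

lemma of_int_neq_0_if_small:
  assumes "z \<noteq> 0" "CHAR('a::ring_1) = 0 \<or> \<bar>z\<bar> < int CHAR('a)"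
  shows "(of_int z :: 'a) \<noteq> 0"
proof
  assume "(of_int z :: 'a) = 0"
  then have "int CHAR('a) dvd z" by (simp add: of_int_eq_0_iff_char_dvd)
  with assms show False using zdvd_not_zless[of "\<bar>z\<bar>" "int CHAR('a)"] by auto
qed

lemma grid_size_gt:
  fixes K N m n :: nat
  assumes "N + 2 + m * (n * (n - 1)) = K * n"
  shows "(n - 1) * m < K"
proof -
  have "(n - 1) * m * n < K * n" using assms by (simp add: algebra_simps)
  then show ?thesis by simp
qed

text \<open>For \<open>n = 2\<close> the characteristic can equal \<open>K\<close>, so that \<open>{0..K}\<close> does not embed into the
  field; this is why the first and last side of the grid have only \<open>K\<close> points.\<close>

lemma grid_size_le_characteristic:
  fixes K N m n p :: nat
  assumes n: "2 \<le> n" and N: "N + 2 + m * (n * (n - 1)) = K * n"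
    and p: "m * n < p" "N < p"
  shows "K \<le> p" and "2 < n \<Longrightarrow> K < p"
proof -
  have "K > (n - 1) * m" using N by (rule grid_size_gt)
  \<comment> \<open>In terms of the excess \<open>q\<close>, the equation for \<open>N\<close>
    becomes \<open>N + 2 = n * q\<close>.\<close>
  then obtain q where q: "K = (n - 1) * m + q" "0 < q"
    by (metis add_diff_inverse_nat less_imp_add_positive)
  have "N + 2 + m * (n * (n - 1)) = n * q + m * (n * (n - 1))"
    using N by (simp add: q algebra_simps)
  then have nq: "N + 2 = n * q" by simp
  have "K \<le> p \<and> (2 < n \<longrightarrow> K < p)"
  proof (cases "q \<le> m")
    case True
    then have "K \<le> (n - 1) * m + m" using q by simp
    also have "\<dots> = m * n" using n by (cases n) (simp_all add: algebra_simps)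
    finally show ?thesis using p by simp
  next
    case False
    \<comment> \<open>From \<open>m \<le> q - 1\<close> follows
      \<open>K \<le> (n - 1) * (q - 1) + q = N + 3 - n\<close>, which is \<open>N + 1\<close> for
      \<open>n = 2\<close> and at most \<open>N\<close> for \<open>n > 2\<close>.\<close>
    then have "(n - 1) * m \<le> (n - 1) * (q - 1)" by (intro mult_left_mono) auto
    moreover have "(n - 1) * (q - 1) + q + n = n * q + 1"
      using n \<open>0 < q\<close> by (cases n; cases q) (simp_all add: algebra_simps)
    ultimately show ?thesis using q nq p n by linarith
  qed
  then show "K \<le> p" "2 < n \<Longrightarrow> K < p" by auto
qed

section \<open>The coefficient as a single product on a small grid\<close>

text \<open>Dividing by \<open>x 1 * x n\<close> costs one point on two sides. Dropping opposite
  ends confines the sums of separated points to the interval from \<open>m n (n - 1) / 2 + 1\<close>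
  to \<open>K n - m n (n - 1) / 2 - 1\<close>, whose length is \<open>N\<close>.\<close>

definition point_range :: "nat \<Rightarrow> nat \<Rightarrow> nat \<Rightarrow> int set" where
  "point_range n K i = {(if i = 1 then 1 else 0)..(if i = n then int K - 1 else int K)}"

text \<open>The grid point with the least sum among those whose shifted difference factors do not vanish.\<close>

definition peak :: "nat \<Rightarrow> nat \<Rightarrow> nat \<Rightarrow> int" where
  "peak n m i = (if i = 1 then int m * (int n - 1) + 1 else int m * (int i - 2))"

text \<open>At \<open>2, ..., n, 1\<close> the values are \<open>0, m, ..., m * (n - 2)\<close> and
  \<open>m * (n - 1) + 1\<close>. For \<open>i < j\<close> the difference is \<open>- m * d\<close>,
  or \<open>m * d + 1\<close> if \<open>i = 1\<close>, with \<open>1 \<le> d \<le> n - 1\<close>: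
  outside the interval of shifts, and within \<open>m * n\<close> of each shift.\<close>

lemma peak_difference:
  assumes "(i, j) \<in> index_pairs n" "s \<in> {1 - int m..int m}"
  shows "peak n m i - peak n m j - s \<noteq> 0" and "\<bar>peak n m i - peak n m j - s\<bar> \<le> int (m * n)"
proof -
  have ij: "1 \<le> i" "i < j" "j \<le> n" using assms by (auto simp: index_pairs_def)
  have mn: "int m * (int n - 1) = int (m * n) - int m" by (simp add: algebra_simps)
  have s: "1 - int m \<le> s" "s \<le> int m" using assms(2) by auto
  have "peak n m i - peak n m j - s \<noteq> 0 \<and> \<bar>peak n m i - peak n m j - s\<bar> \<le> int (m * n)"
  proof (cases "i = 1")
    case True
    define d where "d = int n + 1 - int j"
    have d: "1 \<le> d" "d \<le> int n - 1" using ij True by (auto simp: d_def)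
    have "int m * 1 \<le> int m * d" "int m * d \<le> int m * (int n - 1)"
      using d mult_left_mono[of 1 d "int m"] mult_left_mono[of d "int n - 1" "int m"] by simp_all
    moreover have "peak n m i - peak n m j = int m * d + 1"
      using ij True by (simp add: peak_def d_def algebra_simps)
    ultimately have "1 \<le> peak n m i - peak n m j - s" "peak n m i - peak n m j - s \<le> int (m * n)"
      using s mn by linarith+
    then show ?thesis by linarith
  next
    case False
    define d where "d = int j - int i"
    have d: "1 \<le> d" "d \<le> int n - 1" using ij by (auto simp: d_def)
    have "int m * 1 \<le> int m * d" "int m * d \<le> int m * (int n - 1)"
      using d mult_left_mono[of 1 d "int m"] mult_left_mono[of d "int n - 1" "int m"] by simp_all
    moreover have "peak n m i - peak n m j = - (int m * d)"
      using ij False by (simp add: peak_def d_def algebra_simps)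
    ultimately have "peak n m i - peak n m j - s \<le> - 1" "- int (m * n) \<le> peak n m i - peak n m j - s"
      using s mn by linarith+
    then show ?thesis by linarith
  qed
  then show "peak n m i - peak n m j - s \<noteq> 0" "\<bar>peak n m i - peak n m j - s\<bar> \<le> int (m * n)"
    by auto
qed

lemma sum_peak:
  assumes "0 < n"
  shows "2 * (\<Sum>i=1..n. peak n m i) = int m * (int n * (int n - 1)) + 2"
proof -
  have "2 * (\<Sum>i=2..l. peak n m i) = int m * ((int l - 1) * (int l - 2))" if "1 \<le> l" for l
    using that
  proof (induction l rule: dec_induct)
    case base
    then show ?case by simp
  next
    case (step l)
    then have "(\<Sum>i=2..Suc l. peak n m i) = (\<Sum>i=2..l. peak n m i) + int m * (int l - 1)"
      by (simp add: peak_def)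
    with step show ?case by (simp add: algebra_simps)
  qed
  from this[of n] have "2 * (\<Sum>i=2..n. peak n m i) = int m * ((int n - 1) * (int n - 2))"
    using assms by simp
  moreover have "(\<Sum>i=1..n. peak n m i) = peak n m 1 + (\<Sum>i=2..n. peak n m i)"
    using assms by (simp add: sum.atLeast_Suc_atMost numeral_2_eq_2)
  ultimately show ?thesis by (simp add: peak_def algebra_simps)
qed

text \<open>The two bounds for separated sequences confine the sum to \<open>N + 1\<close>
  consecutive values, the least being that of \<open>peak\<close>. Excluding the others leaves the
  equality case of \<open>separated_sum_first_pos\<close>, which determines the point.\<close>

lemma separated_grid_point_eq_peak:
  fixes z :: "nat \<Rightarrow> int"
  assumes n: "2 \<le> n" and N: "N + 2 + m * (n * (n - 1)) = K * n"
    and range: "\<And>i. i \<in> {1..n} \<Longrightarrow> z i \<in> point_range n K i"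
    and diff: "\<And>i j. (i, j) \<in> index_pairs n \<Longrightarrow> z i - z j \<notin> {1 - int m..int m}"
    and sum: "sum z {1..n} \<notin> {sum (peak n m) {1..n} + 1..sum (peak n m) {1..n} + int N}"
    and i: "i \<in> {1..n}"
  shows "z i = peak n m i"
proof -
  have sep: "z i + int m \<le> z j \<or> z j + int m < z i"
    if "i \<in> {1..n}" "j \<in> {1..n}" "i < j" for i j
    using diff[of i j] that by (auto simp: index_pairs_def)
  have bounds: "0 \<le> z i" "z i \<le> int K" if "i \<in> {1..n}" for i
    using range[OF that] by (auto simp: point_range_def split: if_splits)
  have ends: "0 < z 1" "z n < int K"
    using range[of 1] range[of n] n by (auto simp: point_range_def)
  have N': "int N + 2 + int m * (int n * (int n - 1)) = int K * int n"
    using n arg_cong[OF N, of int] by (simp add: of_nat_diff)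
  have n0: "0 < n" using n by simp
  have lower: "int m * (int n * (int n - 1)) + 2 \<le> 2 * sum z {1..n}"
    by (rule separated_sum_first_pos(1)[of n z m, OF n0 _ ends(1)]) (erule bounds | erule (2) sep)+
  have upper: "2 * sum z {1..n} \<le> 2 * (int K * int n) - int m * (int n * (int n - 1)) - 2"
    by (rule separated_sum_last_less[of n z _ m, OF n0 _ ends(2)]) (erule bounds | erule (2) sep)+
  have eq: "2 * sum z {1..n} = int m * (int n * (int n - 1)) + 2"
    using lower upper N' sum sum_peak[OF n0, of m] by auto
  show ?thesis
    unfolding peak_def
    by (rule separated_sum_first_pos(2)[of n z m i, OF n0 _ ends(1) _ eq i]) (erule bounds | erule (2) sep)+
qed

lemma leading_coefficient_nonzero:
  fixes n m K N :: nat
  assumes n: "2 \<le> n" and N: "N + 2 + m * (n * (n - 1)) = K * n"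
    and char: "CHAR('a::field) = 0 \<or> m * n < CHAR('a) \<and> N < CHAR('a)"
  obtains B :: "nat \<Rightarrow> 'a::field set" where
    "\<And>i. i \<in> {1..n} \<Longrightarrow> finite (B i)"
    "\<And>i. i \<in> {1..n} \<Longrightarrow> card (B i) = (if i = 1 \<or> i = n then K else Suc K)"
    "grid_functional {1..n} B (\<lambda>x. difference_power n m x * (\<Sum>i=1..n. x i) ^ N) \<noteq> 0"
proof
  define B :: "nat \<Rightarrow> 'a set" where "B i = of_int ` point_range n K i" for i
  define d where "d i = (if i = 1 \<or> i = n then K - 1 else K)" for i
  have K: "0 < K" using N by (cases K) auto
  show finB: "finite (B i)" for i by (simp add: B_def point_range_def)
  show cardB: "card (B i) = (if i = 1 \<or> i = n then K else Suc K)" if "i \<in> {1..n}" for i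
  proof -
    \<comment> \<open>Differences are at most \<open>K - 1\<close> on the two short sides and at
      most \<open>K\<close> on the full sides, which occur only for \<open>n > 2\<close>.\<close>
    have "CHAR('a) = 0 \<or> \<bar>a - b\<bar> < int CHAR('a)" if "a \<in> point_range n K i" "b \<in> point_range n K i" for a b
    proof (cases "CHAR('a) = 0")
      case False
      then have p: "m * n < CHAR('a)" "N < CHAR('a)" using char by auto
      note le = grid_size_le_characteristic[OF n N p]
      show ?thesis
        using that \<open>i \<in> {1..n}\<close> le by (cases "2 < n") (auto simp: point_range_def split: if_splits)
    qed simp
    then have "(of_int (a - b) :: 'a) \<noteq> 0" if "a \<in> point_range n K i" "b \<in> point_range n K i" "a \<noteq> b" for a b
      using that by (intro of_int_neq_0_if_small) auto
    then have "inj_on (of_int :: int \<Rightarrow> 'a) (point_range n K i)"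
      by (intro inj_onI) (metis eq_iff_diff_eq_0 of_int_diff)
    then show ?thesis using n K by (auto simp: B_def card_image point_range_def)
  qed
  have cardB': "card (B i) = Suc (d i)" if "i \<in> {1..n}" for i
    using cardB[OF that] K by (simp add: d_def)
  have "sum d {1..n} + 2 = K * n"
  proof -
    have "{1..n} = insert 1 (insert n {2..<n})" using n by auto
    then have "sum d {1..n} = d 1 + (d n + sum d {2..<n})" using n by simp
    also have "sum d {2..<n} = (\<Sum>i\<in>{2..<n}. K)" by (intro sum.cong) (auto simp: d_def)
    finally have "sum d {1..n} + 2 = 2 * K + (n - 2) * K" using K by (simp add: d_def)
    also have "\<dots> = K * n" using n by (simp add: algebra_simps flip: add_mult_distrib2)
    finally show ?thesis .
  qed
  then have deg: "sum d {1..n} = 2 * m * card (index_pairs n) + N"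
    using N card_index_pairs[of n] by (simp add: algebra_simps)
  define \<sigma> where "\<sigma> = sum (peak n m) {1..n}"
  \<comment> \<open>Avoiding the \<open>2 * m\<close> shifts, which are not symmetric about zero,
    means \<open>z i + m \<le> z j\<close> or \<open>z j + m < z i\<close>. The \<open>N\<close>
    shifts above \<open>\<sigma>\<close> remove all admissible sums but the least.\<close>
  define G where "G x = (\<Prod>(i, j)\<in>index_pairs n. \<Prod>s\<in>{1 - int m..int m}. x i - x j - of_int s) *
      (\<Prod>t\<in>{\<sigma> + 1..\<sigma> + int N}. (\<Sum>i=1..n. x i) - of_int t)" for x :: "nat \<Rightarrow> 'a"
  have "same_top {1..n} (sum d {1..n}) G (\<lambda>x. difference_power n m x * (\<Sum>i=1..n. x i) ^ N)"
    using same_top_mult[OF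
        same_top_difference_power[of n "\<lambda>_ _. {1 - int m..int m}" m of_int]
        same_top_prod_sum_shift[of "{1..n}" "{\<sigma> + 1..\<sigma> + int N}" 0 of_int]]
    unfolding deg by (simp add: G_def[abs_def] nat_mult_distrib)
  then have eq: "grid_functional {1..n} B (\<lambda>x. difference_power n m x * (\<Sum>i=1..n. x i) ^ N) =
      grid_functional {1..n} B G"
    using grid_functional_same_top[of "{1..n}" B d] finB cardB' by simp
  define pt where "pt = restrict (\<lambda>i. of_int (peak n m i) :: 'a) {1..n}"
  have only: "x = pt" if x: "x \<in> PiE {1..n} B" and "G x \<noteq> 0" for x
  proof -
    have "\<forall>i\<in>{1..n}. \<exists>z. z \<in> point_range n K i \<and> x i = of_int z"
      using x by (force simp: B_def PiE_iff)
    then obtain z where z: "\<And>i. i \<in> {1..n} \<Longrightarrow> z i \<in> point_range n K i"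
      "\<And>i. i \<in> {1..n} \<Longrightarrow> x i = of_int (z i)" by metis
    have "z i = peak n m i" if "i \<in> {1..n}" for i
    proof (rule separated_grid_point_eq_peak[OF n N])
      fix i j assume ij: "(i, j) \<in> index_pairs n"
      show "z i - z j \<notin> {1 - int m..int m}"
      proof
        assume "z i - z j \<in> {1 - int m..int m}"
        moreover have "x i - x j - of_int (z i - z j) = 0"
          using ij z(2)[of i] z(2)[of j] by (auto simp: index_pairs_def)
        ultimately have "(\<Prod>s\<in>{1 - int m..int m}. x i - x j - of_int s) = 0"
          by - (intro prod_zero bexI[of _ "z i - z j"], simp_all)
        with ij have "G x = 0" unfolding G_def by (force intro: prod_zero)
        with \<open>G x \<noteq> 0\<close> show False by simp
      qed
    next
      have "(\<Sum>i=1..n. x i) - of_int (sum z {1..n}) = 0"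
        using z(2) by simp
      then show "sum z {1..n} \<notin> {sum (peak n m) {1..n} + 1..sum (peak n m) {1..n} + int N}"
        using \<open>G x \<noteq> 0\<close> by (auto simp: G_def \<sigma>_def simp del: of_int_sum)
    qed (use z that in auto)
    with z x show "x = pt" by (auto simp: pt_def PiE_iff extensional_def fun_eq_iff)
  qed
  \<comment> \<open>As integers these factors are nonzero and at most \<open>m * n\<close> in
    absolute value, while those of \<open>nz2\<close> lie between \<open>- N\<close> and
    \<open>- 1\<close>; each bound on the characteristic handles one kind.\<close>
  have nz1: "(of_int (peak n m i - peak n m j - s) :: 'a) \<noteq> 0"
    if "(i, j) \<in> index_pairs n" "s \<in> {1 - int m..int m}" for i j s
  proof (rule of_int_neq_0_if_small)
    have "CHAR('a) = 0 \<or> int (m * n) < int CHAR('a)"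
      using char by (auto simp del: of_nat_mult)
    then show "CHAR('a) = 0 \<or> \<bar>peak n m i - peak n m j - s\<bar> < int CHAR('a)"
      using peak_difference(2)[OF that] le_less_trans by blast
  qed (rule peak_difference(1)[OF that])
  have nz2: "(of_int (\<sigma> - t) :: 'a) \<noteq> 0" if "t \<in> {\<sigma> + 1..\<sigma> + int N}" for t
    using that char by (intro of_int_neq_0_if_small) auto
  have "(\<Prod>s\<in>{1 - int m..int m}. pt i - pt j - of_int s) \<noteq> 0" if "(i, j) \<in> index_pairs n" for i j
  proof -
    have "pt i - pt j - of_int s = of_int (peak n m i - peak n m j - s)" for s
      using that by (simp add: pt_def index_pairs_def)
    with nz1[OF that] show ?thesis by (simp del: of_int_diff)
  qed
  moreover have "(\<Prod>t\<in>{\<sigma> + 1..\<sigma> + int N}. (\<Sum>i=1..n. pt i) - of_int t) \<noteq> 0"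
  proof -
    have "(\<Sum>i=1..n. pt i) - of_int t = of_int (\<sigma> - t)" for t
      by (simp add: pt_def \<sigma>_def)
    with nz2 show ?thesis by (simp del: of_int_diff)
  qed
  ultimately have "G pt \<noteq> 0"
    unfolding G_def by (simp add: case_prod_unfold)
  have "peak n m i \<in> point_range n K i" if "i \<in> {1..n}" for i
  proof -
    have K1: "int m * (int n - 1) + 1 \<le> int K"
      using grid_size_gt[OF N] n by (simp add: of_nat_diff mult.commute flip: of_nat_less_iff[where 'a = int])
    have "int m * (int i - 2) \<le> int m * (int n - 1)" using that by (intro mult_left_mono) auto
    moreover have "int m * (int i - 2) \<ge> 0" if "i \<noteq> 1" using that \<open>i \<in> {1..n}\<close> by auto
    moreover have "int m * (int n - 1) \<ge> 0" using n by auto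
    ultimately show ?thesis using K1 n by (auto simp: point_range_def peak_def)
  qed
  then have pt: "pt \<in> PiE {1..n} B" by (auto simp: pt_def B_def)
  have "grid_functional {1..n} B G =
      (\<Sum>x\<in>{pt}. G x / (\<Prod>i=1..n. \<Prod>c\<in>B i - {x i}. x i - c))"
    unfolding grid_functional_def using pt only finB
    by (intro sum.mono_neutral_right) (auto intro: finite_PiE)
  also have "\<dots> \<noteq> 0"
    using \<open>G pt \<noteq> 0\<close> finB by auto
  finally show "grid_functional {1..n} B
      (\<lambda>x. difference_power n m x * (\<Sum>i=1..n. x i) ^ N) \<noteq> 0"
    using eq by simp
qed

section \<open>Symmetrization of the quadratic form\<close>

lemma obtain_permutation_two:
  fixes a b i j :: 'b
  assumes "a \<in> V" "b \<in> V" "a \<noteq> b" "i \<in> V" "j \<in> V" "i \<noteq> j"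
  obtains \<pi> where "\<pi> permutes V" "\<pi> a = i" "\<pi> b = j"
proof
  let ?j = "transpose a i j"
  have j: "?j \<in> V" "a \<noteq> ?j"
    using assms by (auto simp: transpose_def)
  then show "transpose a i \<circ> transpose b ?j permutes V"
    using assms by (intro permutes_compose permutes_swap_id)
  show "(transpose a i \<circ> transpose b ?j) a = i" using assms j by simp
  show "(transpose a i \<circ> transpose b ?j) b = j" by simp
qed

text \<open>Some permutation carries \<open>a, b\<close> to any given pair
  \<open>i \<noteq> j\<close> of \<open>T\<close>. As \<open>D\<close> and the constant grid are
  invariant, all monomials \<open>x i * x j\<close> contribute equally and only the sum of the
  \<open>\<alpha> i j\<close> remains.\<close>

lemma grid_functional_quadratic_symmetric:
  fixes D :: "(nat \<Rightarrow> 'a::field) \<Rightarrow> 'a"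
  assumes D: "\<And>\<pi> x. \<pi> permutes V \<Longrightarrow> D (x \<circ> \<pi>) = D x"
    and T: "T \<subseteq> V" and ab: "a \<in> V" "b \<in> V" "a \<noteq> b"
  shows "grid_functional V (\<lambda>_. E) (\<lambda>x. (\<Sum>i\<in>T. \<Sum>j\<in>T - {i}. \<alpha> i j * x i * x j) * D x) =
    (\<Sum>i\<in>T. \<Sum>j\<in>T - {i}. \<alpha> i j) * grid_functional V (\<lambda>_. E) (\<lambda>x. x a * x b * D x)"
proof -
  have sym: "grid_functional V (\<lambda>_. E) (\<lambda>x. x i * x j * D x) =
      grid_functional V (\<lambda>_. E) (\<lambda>x. x a * x b * D x)"
    if "i \<in> T" "j \<in> T - {i}" for i j
  proof -
    from that T have "i \<in> V" "j \<in> V" "i \<noteq> j" by auto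
    with ab obtain \<pi> where \<pi>: "\<pi> permutes V" "\<pi> a = i" "\<pi> b = j"
      using obtain_permutation_two by metis
    from grid_functional_permute[OF \<pi>(1), of E "\<lambda>x. x a * x b * D x"] show ?thesis
      using \<pi> D by simp
  qed
  have "(\<Sum>i\<in>T. \<Sum>j\<in>T - {i}. \<alpha> i j * x i * x j) * D x =
      (\<Sum>i\<in>T. \<Sum>j\<in>T - {i}. \<alpha> i j * (x i * x j * D x))" for x
    by (simp add: sum_distrib_right mult.assoc)
  then have "grid_functional V (\<lambda>_. E) (\<lambda>x. (\<Sum>i\<in>T. \<Sum>j\<in>T - {i}. \<alpha> i j * x i * x j) * D x) =
      (\<Sum>i\<in>T. \<Sum>j\<in>T - {i}. \<alpha> i j * grid_functional V (\<lambda>_. E) (\<lambda>x. x i * x j * D x))"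
    by (simp add: grid_functional_sum grid_functional_cmult)
  also have "\<dots> = (\<Sum>i\<in>T. \<Sum>j\<in>T - {i}. \<alpha> i j * grid_functional V (\<lambda>_. E) (\<lambda>x. x a * x b * D x))"
    using sym by (intro sum.cong refl) simp
  finally show ?thesis by (simp add: sum_distrib_right)
qed

section \<open>The lower bound for the restricted sumset\<close>

lemma finite_restricted_sumset:
  assumes "\<And>i. i \<in> {1..n} \<Longrightarrow> finite (A i)"
  shows "finite (restricted_sumset n T A S \<alpha>)"
proof (rule finite_subset)
  show "restricted_sumset n T A S \<alpha> \<subseteq> (\<lambda>a. \<Sum>i=1..n. a i) ` PiE {1..n} A"
  proof
    fix c assume "c \<in> restricted_sumset n T A S \<alpha>"
    then obtain a where "c = (\<Sum>i=1..n. a i)" "\<forall>i\<in>{1..n}. a i \<in> A i"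
      by (auto simp: restricted_sumset_def)
    then have "c = (\<Sum>i=1..n. restrict a {1..n} i)" "restrict a {1..n} \<in> PiE {1..n} A"
      by auto
    then show "c \<in> (\<lambda>a. \<Sum>i=1..n. a i) ` PiE {1..n} A" by blast
  qed
  show "finite ((\<lambda>a. \<Sum>i=1..n. a i) ` PiE {1..n} A)"
    using assms by (intro finite_imageI finite_PiE) auto
qed

lemma card_restricted_sumset_gt:
  fixes n m K N :: nat and A :: "nat \<Rightarrow> 'a::field set"
  assumes n: "2 \<le> n" and N: "N + 2 + m * (n * (n - 1)) = K * n"
    and T: "T \<subseteq> {1..n}"
    and finA: "\<And>i. i \<in> {1..n} \<Longrightarrow> finite (A i)"
    and cardA: "\<And>i. i \<in> {1..n} \<Longrightarrow> card (A i) = Suc K"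
    and finS: "\<And>i j. (i, j) \<in> index_pairs n \<Longrightarrow> finite (S i j)"
    and cardS: "\<And>i j. (i, j) \<in> index_pairs n \<Longrightarrow> card (S i j) \<le> 2 * m"
    and \<alpha>: "(\<Sum>i\<in>T. \<Sum>j\<in>T - {i}. \<alpha> i j) \<noteq> 0"
    and char: "CHAR('a) = 0 \<or> m * n < CHAR('a) \<and> N < CHAR('a)"
  shows "N < card (restricted_sumset n T A S \<alpha>)"
proof (rule ccontr)
  define V where "V = {1..n}"
  define C where "C = restricted_sumset n T A S \<alpha>"
  assume "\<not> N < card (restricted_sumset n T A S \<alpha>)"
  then have C: "card C \<le> N" "finite C"
    using finite_restricted_sumset[OF finA] by (auto simp: C_def)
  define quad where "quad x = (\<Sum>i\<in>T. \<Sum>j\<in>T - {i}. \<alpha> i j * x i * x j)" for x :: "nat \<Rightarrow> 'a"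
  \<comment> \<open>The padding powers here and in \<open>h\<close> fix the degree: the top-degree
    part then depends only on \<open>m\<close>, \<open>n\<close> and \<open>N\<close>, not on the
    sizes of \<open>S i j\<close> and \<open>C\<close>.\<close>
  define g where "g x = (\<Prod>(i, j)\<in>index_pairs n.
      (\<Prod>s\<in>S i j. x i - x j - s) * (x i - x j) ^ (2 * m - card (S i j)))" for x :: "nat \<Rightarrow> 'a"
  define h where "h x = (\<Prod>c\<in>C. (\<Sum>i\<in>V. x i) - c) * (\<Sum>i\<in>V. x i) ^ (N - card C)"
    for x :: "nat \<Rightarrow> 'a"
  define D where "D x = difference_power n m x * (\<Sum>i\<in>V. x i) ^ N" for x :: "nat \<Rightarrow> 'a"
  have vanish: "quad x * (g x * h x) = 0" if x: "x \<in> PiE V A" for x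
  proof (rule ccontr)
    assume "quad x * (g x * h x) \<noteq> 0"
    then have nz: "quad x \<noteq> 0" "g x \<noteq> 0" "h x \<noteq> 0" by auto
    have diff: "x i - x j \<notin> S i j" if ij: "(i, j) \<in> index_pairs n" for i j
    proof
      assume "x i - x j \<in> S i j"
      then have "(\<Prod>s\<in>S i j. x i - x j - s) = 0"
        using finS[OF ij] by (intro prod_zero) auto
      then have "g x = 0"
        unfolding g_def by (intro prod_zero[OF finite_index_pairs] bexI[OF _ ij]) simp
      with nz show False by simp
    qed
    have "\<forall>i\<in>{1..n}. x i \<in> A i" using x by (auto simp: V_def)
    moreover have "\<forall>i\<in>{1..n}. \<forall>j\<in>{1..n}. i < j \<longrightarrow> x i - x j \<notin> S i j"
      using diff by (simp add: index_pairs_def)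
    ultimately have "(\<Sum>i\<in>V. x i) \<in> C"
      using nz(1) unfolding C_def restricted_sumset_def quad_def V_def by blast
    then have "(\<Prod>c\<in>C. (\<Sum>i\<in>V. x i) - c) = 0"
      by (intro prod_zero[OF C(2)] bexI[of _ "\<Sum>i\<in>V. x i"]) simp_all
    then have "h x = 0" by (simp add: h_def)
    with nz show False by simp
  qed
  have gD: "same_top V (2 * m * card (index_pairs n) + N) (\<lambda>x. g x * h x) D"
    using same_top_mult[OF same_top_difference_power[of n S m "\<lambda>s. s"]
        same_top_prod_sum_shift[of "{1..n}" C "N - card C" "\<lambda>c. c"]] cardS C
    by (simp add: g_def[abs_def] h_def[abs_def] D_def[abs_def] V_def)
  have "poly_fun V (2 + Suc 0) (\<lambda>x. \<alpha> i j * x i * x j)" if "i \<in> T" "j \<in> T" for i j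
    using that T
    by (intro poly_fun_mult poly_fun_cmult poly_fun_var) (auto simp: V_def)
  then have quad: "poly_fun V (Suc 2) quad"
    unfolding quad_def[abs_def] by (intro poly_fun_sum) auto
  have deg: "2 + (2 * m * card (index_pairs n) + N) = (\<Sum>i\<in>V. K)"
    using N card_index_pairs[of n] by (simp add: V_def algebra_simps)
  have top: "same_top V (\<Sum>i\<in>V. K) (\<lambda>x. quad x * (g x * h x)) (\<lambda>x. quad x * D x)"
    using same_top_mult[OF same_top_refl[OF quad] gD] unfolding deg .
  have "grid_functional V A (\<lambda>x. quad x * D x) = grid_functional V A (\<lambda>x. quad x * (g x * h x))"
    using grid_functional_same_top[OF _ _ _ top, of A] finA cardA by (simp add: V_def)
  also have "\<dots> = 0"
    unfolding grid_functional_def using vanish by (intro sum.neutral) auto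
  finally have zero: "grid_functional V A (\<lambda>x. quad x * D x) = 0" .
  \<comment> \<open>Symmetry needs one node set for all coordinates, and any \<open>Suc K\<close>
    field elements give the same coefficient. \<open>A 1\<close> is such a set, whereas
    \<open>{0..K}\<close> need not embed into the field.\<close>
  define E where "E = A 1"
  have E: "finite E" "card E = Suc K" using finA[of 1] cardA[of 1] n by (auto simp: E_def)
  have "grid_functional V A (\<lambda>x. quad x * D x) = grid_functional V (\<lambda>_. E) (\<lambda>x. quad x * D x)"
    using grid_functional_shift[of V A "\<lambda>_. E" "\<lambda>_. K" "\<lambda>_. 0" "\<lambda>x. quad x * D x"]
      finA cardA E top by (simp add: V_def same_top_def)
  also have "\<dots> = (\<Sum>i\<in>T. \<Sum>j\<in>T - {i}. \<alpha> i j) * grid_functional V (\<lambda>_. E) (\<lambda>x. x 1 * x n * D x)"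
    unfolding quad_def
  proof (rule grid_functional_quadratic_symmetric)
    fix \<pi> :: "nat \<Rightarrow> nat" and x :: "nat \<Rightarrow> 'a" assume \<pi>: "\<pi> permutes V"
    show "D (x \<circ> \<pi>) = D x"
      using \<pi> difference_power_permute[of \<pi> n m x] sum.permute[OF \<pi>, of x]
      by (simp add: D_def V_def comp_def)
  qed (use n T in \<open>auto simp: V_def\<close>)
  finally have coeff: "grid_functional V (\<lambda>_. E) (\<lambda>x. x 1 * x n * D x) = 0"
    using zero \<alpha> by simp
  obtain B :: "nat \<Rightarrow> 'a set" where B: "\<And>i. i \<in> V \<Longrightarrow> finite (B i)"
    "\<And>i. i \<in> V \<Longrightarrow> card (B i) = (if i = 1 \<or> i = n then K else Suc K)"
    "grid_functional V B D \<noteq> 0"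
    using leading_coefficient_nonzero[OF n N char] unfolding V_def D_def by blast
  \<comment> \<open>The exponents \<open>K\<close> split into those of \<open>x 1 * x n\<close>, in
    \<open>e\<close>, and the rest \<open>d\<close>, so that \<open>grid_functional_shift\<close>
    passes from \<open>E\<close> to the smaller grid \<open>B\<close>.\<close>
  define d where "d i = (if i = 1 \<or> i = n then K - 1 else K)" for i
  define e where "e i = (if i = 1 \<or> i = n then 1 else 0 :: nat)" for i
  have K: "0 < K" using N by (cases K) auto
  have V: "V = insert 1 (insert n {2..<n})" using n by (auto simp: V_def)
  have e: "(\<Prod>i\<in>V. x i ^ e i) = x 1 * x n" for x :: "nat \<Rightarrow> 'a"
  proof -
    have "(\<Prod>i\<in>{2..<n}. x i ^ e i) = 1" by (intro prod.neutral) (auto simp: e_def)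
    then show ?thesis using n by (simp add: V) (simp add: e_def)
  qed
  have "sum e V = 2"
  proof -
    have "sum e {2..<n} = 0" by (auto simp: e_def)
    then show ?thesis using n by (simp add: V) (simp add: e_def)
  qed
  moreover have "sum d V + sum e V = (\<Sum>i\<in>V. K)"
    unfolding sum.distrib[symmetric] using K by (intro sum.cong) (auto simp: d_def e_def)
  ultimately have "sum d V = 2 * m * card (index_pairs n) + N" using deg by simp
  then have "poly_fun V (Suc (sum d V)) D" using gD by (simp add: same_top_def)
  then have "grid_functional V (\<lambda>_. E) (\<lambda>x. x 1 * x n * D x) = grid_functional V B D"
    using grid_functional_shift[of V "\<lambda>_. E" B d e D] B E K
    by (simp add: e) (simp add: V_def d_def e_def)
  with coeff B(3) show False by simp
qed

theorem theorem1p7: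
  fixes n k m :: nat
    and T :: "nat set"
    and A :: "nat \<Rightarrow> 'a::field set"
    and S :: "nat \<Rightarrow> nat \<Rightarrow> 'a set"
    and \<alpha> :: "nat \<Rightarrow> nat \<Rightarrow> 'a"
  assumes "n > 0"
    and "T \<noteq> {}" and "T \<subseteq> {1..n}"
    and "\<And>i. i \<in> {1..n} \<Longrightarrow> finite (A i) \<and> card (A i) = k"
    and "\<And>i j. i \<in> {1..n} \<Longrightarrow> j \<in> {1..n} \<Longrightarrow> i < j \<Longrightarrow> finite (S i j) \<and> card (S i j) \<le> 2 * m"
    and "(\<Sum>i\<in>T. \<Sum>j\<in>T - {i}. \<alpha> i j) \<noteq> 0"
    and "CHAR('a) = 0 \<or>
         int CHAR('a) > max (int m * int n)
                            ((int k - 1) * int n - int m * int n * (int n - 1) - 2)"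
  shows "int (card (restricted_sumset n T A S \<alpha>)) \<ge> (int k + int m - int m * int n - 1) * int n - 1"
proof (cases "(int k - 1) * int n - int m * int n * (int n - 1) - 2 < 0")
  case True
  \<comment> \<open>The claimed bound is one more than a negative integer, hence at most
    zero.\<close>
  have "(int k + int m - int m * int n - 1) * int n - 1 =
      (int k - 1) * int n - int m * int n * (int n - 1) - 1"
    by (simp add: algebra_simps)
  with True show ?thesis by simp
next
  case False
  define N where "N = nat ((int k - 1) * int n - int m * int n * (int n - 1) - 2)"
  have N: "int N = (int k - 1) * int n - int m * int n * (int n - 1) - 2"
    using False by (simp add: N_def)
  \<comment> \<open>For \<open>n = 1\<close> no two distinct indices lie in \<open>T\<close>, so the
    sum of the \<open>\<alpha> i j\<close> would be empty.\<close>
  have n: "2 \<le> n"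
  proof (rule ccontr)
    assume "\<not> 2 \<le> n"
    with assms(1) have "n = 1" by simp
    with assms(3) have "T - {i} = {}" if "i \<in> T" for i using that by auto
    then have "(\<Sum>i\<in>T. \<Sum>j\<in>T - {i}. \<alpha> i j) = 0"
      by - (rule sum.neutral, rule ballI, simp only: sum.empty)
    with assms(6) show False by simp
  qed
  \<comment> \<open>\<open>k = 0\<close> would make \<open>N\<close> negative; for
    \<open>k > 0\<close> the natural number \<open>k - 1\<close> agrees with the integer
    one.\<close>
  have k: "k \<noteq> 0"
  proof
    assume "k = 0"
    moreover have "0 \<le> int m * int n * (int n - 1)" using n by simp
    ultimately show False using N by simp
  qed
  have "int (N + 2 + m * (n * (n - 1))) = int ((k - 1) * n)"
    using N n k by (simp add: of_nat_diff)
  then have N': "N + 2 + m * (n * (n - 1)) = (k - 1) * n" by (simp only: of_nat_eq_iff)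
  have char: "CHAR('a) = 0 \<or> m * n < CHAR('a) \<and> N < CHAR('a)"
    using assms(7) unfolding N[symmetric] by (simp flip: of_nat_mult)
  have "N < card (restricted_sumset n T A S \<alpha>)"
    using assms k by (intro card_restricted_sumset_gt[OF n N' _ _ _ _ _ _ char])
      (auto simp: index_pairs_def)
  moreover have "(int k + int m - int m * int n - 1) * int n - 1 = int N + 1"
    unfolding N by (simp add: algebra_simps)
  ultimately show ?thesis by simp
qed

end
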